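(* Let $p\in(0,1)$ and let $F$ be a PCA with alphabet $\{0,1\}$, neighborhood $\{0,1\}$ whose parameters $\theta_{00},\theta_{01},\theta_{10},\theta_{11}\in[0,1]$ are of the form $$\theta_{00}=\frac{p(1-s)}{1-p},\qquad \theta_{01}=\theta_{10}=s,\qquad \theta_{11}=1-\frac{(1-p)s}{p}\qquad\text{for some } s\in\Bigl[\frac{2p-1}{p},\frac{p}{1-p}\Bigr].$$ Then $\mu_p$ is invariant for $F$ and every line of the associated stationary space-time diagram $(X^n_k)_{k,n\in\mathbb Z}$ consists of i.i.d. random variables: for every straight line $L\subset\mathbb R^2$, the variables $(X^n_k)_{(k,n)\in L\cap\mathbb Z^2}$ are i.i.d. In particular, any two different variables $X^n_k$ and $X^{n'}_{k'}$, $(k,n)\ne(k',n')$, are independent.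
   Context: A PCA with alphabet $\{0,1\}$ and neighborhood $\{0,1\}$ is determined by four parameters $\theta_{xy}\in[0,1]$: the new value of cell $k\in\mathbb Z$ equals $1$ with probability $\theta_{xy}$ when the current values of cells $k$ and $k+1$ are $x$ and $y$, independently for different cells. $\mu_p$ denotes the Bernoulli product measure on $\{0,1\}^{\mathbb Z}$ in which each coordinate equals $1$ with probability $p$; it is invariant if one step of the PCA started from law $\mu_p$ gives law $\mu_p$. The stationary space-time diagram associated with an invariant $\mu_p$ is the random field $(X^n_k)_{k,n\in\mathbb Z}$ such that, for every $n\in\mathbb Z$, $X^n=(X^n_k)_{k\in\mathbb Z}\sim\mu_p$ and, given $(X^m)_{m\le n}$, the variables $(X^{n+1}_k)_{k\in\mathbb Z}$ are independent with $\mathbb P(X^{n+1}_k=1\mid (X^m)_{m\le n})=\theta_{X^n_kX^n_{k+1}}$. *)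

theory Defs
  imports "HOL-Probability.Probability"
begin

text \<open>
  The alphabet \<open>{0,1}\<close> is the type \<^typ>\<open>bool\<close>, with \<^term>\<open>True\<close> in the role of \<open>1\<close>.
  A configuration is a function \<^typ>\<open>int \<Rightarrow> bool\<close>; a PCA with neighborhood \<open>{0,1}\<close> is given by
  \<open>\<theta> :: bool \<Rightarrow> bool \<Rightarrow> real\<close>, where \<open>\<theta> x y\<close> is the probability of the new value \<open>1\<close>.
\<close>

definition config_space :: "(int \<Rightarrow> bool) measure" where
  "config_space = PiM UNIV (\<lambda>_. count_space UNIV)"

definition bernoulli_measure :: "real \<Rightarrow> (int \<Rightarrow> bool) measure" where
  "bernoulli_measure p = PiM UNIV (\<lambda>_. measure_pmf (bernoulli_pmf p))"

definition pca_params :: "(bool \<Rightarrow> bool \<Rightarrow> real) \<Rightarrow> bool" where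
  "pca_params \<theta> \<longleftrightarrow> (\<forall>x y. \<theta> x y \<in> {0..1})"

definition pca_kernel :: "(bool \<Rightarrow> bool \<Rightarrow> real) \<Rightarrow> (int \<Rightarrow> bool) \<Rightarrow> (int \<Rightarrow> bool) measure" where
  "pca_kernel \<theta> x = PiM UNIV (\<lambda>k. measure_pmf (bernoulli_pmf (\<theta> (x k) (x (k + 1)))))"

definition pca_invariant :: "(bool \<Rightarrow> bool \<Rightarrow> real) \<Rightarrow> (int \<Rightarrow> bool) measure \<Rightarrow> bool" where
  "pca_invariant \<theta> \<mu> \<longleftrightarrow> (\<mu> \<bind> pca_kernel \<theta>) = \<mu>"

text \<open>
  Conditional independence of random variables given a sub-sigma-algebra, on the pattern of
  \<open>prob_space.indep_vars\<close>; the conditional probability of an event is the conditional expectation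
  of its indicator.
\<close>

definition cond_indep_vars ::
  "'w measure \<Rightarrow> 'w measure \<Rightarrow> ('i \<Rightarrow> 'b measure) \<Rightarrow> ('i \<Rightarrow> 'w \<Rightarrow> 'b) \<Rightarrow> 'i set \<Rightarrow> bool" where
  "cond_indep_vars M F N Y I \<longleftrightarrow>
     (\<forall>i\<in>I. Y i \<in> measurable M (N i)) \<and>
     (\<forall>J A. J \<subseteq> I \<and> finite J \<and> J \<noteq> {} \<and> (\<forall>j\<in>J. A j \<in> sets (N j)) \<longrightarrow>
        (AE \<omega> in M. real_cond_exp M F (indicator (\<Inter>j\<in>J. Y j -` A j \<inter> space M)) \<omega> =
           (\<Prod>j\<in>J. real_cond_exp M F (indicator (Y j -` A j \<inter> space M)) \<omega>)))"

text \<open>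
  Here and below, \<open>X n k\<close> stands for the variable \<open>X\<^sup>n\<^sub>k\<close>: time \<open>n\<close> comes first, the cell \<open>k\<close> second.
\<close>

definition past_algebra :: "'w measure \<Rightarrow> (int \<Rightarrow> int \<Rightarrow> 'w \<Rightarrow> bool) \<Rightarrow> int \<Rightarrow> 'w measure" where
  "past_algebra M X n = sigma (space M) {X m k -` A \<inter> space M | m k A. m \<le> n}"

definition stationary_diagram ::
  "(bool \<Rightarrow> bool \<Rightarrow> real) \<Rightarrow> (int \<Rightarrow> bool) measure \<Rightarrow> 'w measure \<Rightarrow> (int \<Rightarrow> int \<Rightarrow> 'w \<Rightarrow> bool) \<Rightarrow> bool" where
  "stationary_diagram \<theta> \<mu> M X \<longleftrightarrow>
     prob_space M \<and>
     (\<forall>n k. X n k \<in> measurable M (count_space UNIV)) \<and>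
     (\<forall>n. distr M config_space (\<lambda>\<omega> k. X n k \<omega>) = \<mu>) \<and>
     (\<forall>n. cond_indep_vars M (past_algebra M X n) (\<lambda>_. count_space UNIV) (X (n + 1)) UNIV) \<and>
     (\<forall>n k. AE \<omega> in M.
        real_cond_exp M (past_algebra M X n) (indicator {\<omega> \<in> space M. X (n + 1) k \<omega>}) \<omega>
          = \<theta> (X n k \<omega>) (X n (k + 1) \<omega>))"

definition iid_vars :: "'w measure \<Rightarrow> 'b measure \<Rightarrow> ('i \<Rightarrow> 'w \<Rightarrow> 'b) \<Rightarrow> 'i set \<Rightarrow> bool" where
  "iid_vars M N Y I \<longleftrightarrow>
     prob_space.indep_vars M (\<lambda>_. N) Y I \<and> (\<forall>i\<in>I. \<forall>j\<in>I. distr M N (Y i) = distr M N (Y j))"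

definition straight_line :: "(real \<times> real) set \<Rightarrow> bool" where
  "straight_line L \<longleftrightarrow> affine L \<and> aff_dim L = 1"

end

theory Submission
  imports Defs
begin

text \<open>
  Write \<open>\<pi>\<close> for the Bernoulli law with parameter \<open>p\<close>. The four formulas for \<open>\<theta>\<close> are exactly what makes
  the local rule balanced: if one of the two cells read by the rule is frozen and the other one
  is drawn from \<open>\<pi>\<close>, then the new cell again has law \<open>\<pi>\<close>.

  Now let a row \<open>x\<close> have law \<open>\<mu>\<^sub>p\<close>, freeze one of its cells \<open>x\<^sub>k\<close>, and integrate out the other cells.
  A new cell at a position \<open>\<ge> k\<close> reads a cell to the right of \<open>k\<close>, so the new cells at
  positions \<open>\<ge> k\<close> can be peeled off from right to left, each by integrating the right one of the
  cells that it reads; the new cells at positions \<open>< k\<close> can be peeled off from left to right in the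
  same way. Hence the frozen cell and the whole next row are independent, and the next row is again
  distributed as \<open>\<mu>\<^sub>p\<close> (\<open>nn_integral_cell_and_hits\<close>). Without the frozen cell this is the invariance
  of \<open>\<mu>\<^sub>p\<close>.

  In a space-time diagram, call a past event decoupled at time \<open>n\<close> if it is independent of the
  whole row \<open>X\<^sup>n\<close>. The Markov property and the computation above show that if \<open>A\<close> is decoupled
  at time \<open>n\<close>, then \<open>A \<inter> {X\<^sup>n\<^sub>k \<in> S}\<close> is decoupled at time \<open>n + 1\<close> (\<open>decoupled_step\<close>): revealing a
  single cell of each row never gives information on a later row. So cells at pairwise different
  times are independent, wherever they lie. The lattice points of a straight line either have
  pairwise different times or all have the same time; in the second case independence is
  the product form of \<open>\<mu>\<^sub>p\<close>. The same dichotomy holds for any two different points.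
\<close>

section \<open>Product measures on configurations\<close>

lemma borel_measurable_bool2:
  fixes h :: "bool \<Rightarrow> bool \<Rightarrow> 'b::topological_space"
  assumes [measurable]: "Y \<in> measurable M (count_space UNIV)" "Z \<in> measurable M (count_space UNIV)"
  shows "(\<lambda>w. h (Y w) (Z w)) \<in> borel_measurable M"
proof -
  have "(\<lambda>w. h (Y w) (Z w)) =
      (\<lambda>w. if Y w then if Z w then h True True else h True False
           else if Z w then h False True else h False False)"
    by auto
  then show ?thesis by simp
qed

lemma prod_emb_cylinder:
  assumes "\<And>i. space (M i) = UNIV"
  shows "prod_emb UNIV M J (Pi\<^sub>E J S) = {x. \<forall>j\<in>J. x j \<in> S j}"
  using assms by (auto simp: prod_emb_def)

lemma sets_bernoulli_measure [measurable_cong]: "sets (bernoulli_measure p) = sets config_space"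
  unfolding bernoulli_measure_def config_space_def by (intro sets_PiM_cong) auto

lemma sets_pca_kernel [measurable_cong]: "sets (pca_kernel \<theta> x) = sets config_space"
  unfolding pca_kernel_def config_space_def by (intro sets_PiM_cong) auto

lemma space_config_space [simp]: "space config_space = UNIV"
  by (simp add: config_space_def space_PiM)

lemma space_bernoulli_measure [simp]: "space (bernoulli_measure p) = UNIV"
  by (simp add: bernoulli_measure_def space_PiM)

lemma measurable_cell [measurable]: "(\<lambda>x. x k) \<in> measurable config_space (count_space UNIV)"
  unfolding config_space_def by (rule measurable_component_singleton) simp

lemma cylinder_sets [measurable]:
  "finite J \<Longrightarrow> {x. \<forall>j\<in>J. x j \<in> S j} \<in> sets config_space"
proof -
  assume "finite J"
  then have "{x\<in>space config_space. \<forall>j\<in>J. x j \<in> S j} \<in> sets config_space"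
    by measurable
  then show ?thesis by simp
qed

lemma prob_space_bernoulli_measure: "prob_space (bernoulli_measure p)"
  unfolding bernoulli_measure_def by (intro prob_space_PiM) (rule prob_space_measure_pmf)

lemma emeasure_bernoulli_cylinder:
  "finite J \<Longrightarrow> emeasure (bernoulli_measure p) {x. \<forall>j\<in>J. x j \<in> S j} =
     (\<Prod>j\<in>J. emeasure (bernoulli_pmf p) (S j))"
  using emeasure_PiM_emb[of UNIV "\<lambda>_. measure_pmf (bernoulli_pmf p)" J S]
  by (simp add: prod_emb_cylinder bernoulli_measure_def prob_space_measure_pmf)

lemma emeasure_bernoulli_UNIV: "emeasure (bernoulli_measure p) UNIV = 1"
  using prob_space.emeasure_space_1[OF prob_space_bernoulli_measure, of p] by simp

lemma emeasure_pca_kernel_cylinder: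
  "finite J \<Longrightarrow> emeasure (pca_kernel \<theta> x) {x. \<forall>j\<in>J. x j \<in> S j} =
     (\<Prod>j\<in>J. emeasure (bernoulli_pmf (\<theta> (x j) (x (j + 1)))) (S j))"
  using emeasure_PiM_emb[of UNIV "\<lambda>k. measure_pmf (bernoulli_pmf (\<theta> (x k) (x (k + 1))))" J S]
  by (simp add: prod_emb_cylinder pca_kernel_def prob_space_measure_pmf)

lemma config_measure_eqI:
  assumes "sets P = sets config_space" "sets Q = sets config_space" "finite_measure P"
    and "\<And>J S. finite J \<Longrightarrow> emeasure P {x. \<forall>j\<in>J. x j \<in> S j} = emeasure Q {x. \<forall>j\<in>J. x j \<in> S j}"
  shows "P = Q"
  using assms(1,2) unfolding config_space_def
  by (rule measure_eqI_PiM_infinite) (simp_all add: prod_emb_cylinder assms)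

lemma measurable_resample_cell:
  "(\<lambda>(v, x). x(m := v)) \<in>
    measurable (measure_pmf (bernoulli_pmf p) \<Otimes>\<^sub>M bernoulli_measure p) config_space"
  (is "?u \<in> measurable ?P _")
  unfolding config_space_def
proof (rule measurable_PiM_single')
  fix i
  have "(\<lambda>z. if i = m then fst z else snd z i) \<in> measurable ?P (count_space UNIV)"
    by (cases "i = m") measurable
  then show "(\<lambda>z. ?u z i) \<in> measurable ?P (count_space UNIV)"
    by (simp add: case_prod_beta fun_upd_def if_distrib cong: if_cong)
qed auto

text \<open>
  Drawing one cell of a \<open>\<mu>\<^sub>p\<close>-distributed row afresh does not change the law of the row. This replaces
  a splitting of the infinite product into one factor and the rest, and thus
  lets every integral stay over the same space.
\<close>

lemma distr_resample_cell:
  "distr (measure_pmf (bernoulli_pmf p) \<Otimes>\<^sub>M bernoulli_measure p) config_space (\<lambda>(v, x). x(m := v))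
     = bernoulli_measure p" (is "distr ?P _ ?u = _")
proof (rule config_measure_eqI)
  interpret B: prob_space "bernoulli_measure p" by (rule prob_space_bernoulli_measure)
  interpret P: pair_prob_space "measure_pmf (bernoulli_pmf p)" "bernoulli_measure p" ..
  note u = measurable_resample_cell[of m p]
  show "finite_measure (distr ?P config_space ?u)"
    using u P.prob_space_distr prob_space.finite_measure by blast
  fix J :: "int set" and S :: "int \<Rightarrow> bool set" assume J: "finite J"
  have "?u -` {x. \<forall>j\<in>J. x j \<in> S j} \<inter> space ?P
      = (if m \<in> J then S m else UNIV) \<times> {x. \<forall>j\<in>J - {m}. x j \<in> S j}"
    by (auto simp: space_pair_measure split: if_splits)
  then have "emeasure (distr ?P config_space ?u) {x. \<forall>j\<in>J. x j \<in> S j}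
      = emeasure ?P ((if m \<in> J then S m else UNIV) \<times> {x. \<forall>j\<in>J - {m}. x j \<in> S j})"
    using u J by (subst emeasure_distr) (auto intro: cylinder_sets)
  also have "\<dots> = emeasure (bernoulli_pmf p) (if m \<in> J then S m else UNIV)
      * (\<Prod>j\<in>J - {m}. emeasure (bernoulli_pmf p) (S j))"
    using J by (subst B.emeasure_pair_measure_Times)
      (auto intro: cylinder_sets simp: sets_bernoulli_measure emeasure_bernoulli_cylinder)
  also have "\<dots> = (\<Prod>j\<in>J. emeasure (bernoulli_pmf p) (S j))"
  proof (cases "m \<in> J")
    case True
    then show ?thesis using J by (simp add: prod.remove)
  next
    case False
    then have "J - {m} = J" by auto
    then show ?thesis using False measure_pmf.emeasure_space_1[of "bernoulli_pmf p"] by simp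
  qed
  also have "\<dots> = emeasure (bernoulli_measure p) {x. \<forall>j\<in>J. x j \<in> S j}"
    using J by (simp add: emeasure_bernoulli_cylinder)
  finally show "emeasure (distr ?P config_space ?u) {x. \<forall>j\<in>J. x j \<in> S j} = \<dots>" .
qed (auto simp: sets_bernoulli_measure)

lemma nn_integral_resample_cell:
  assumes f [measurable]: "f \<in> borel_measurable config_space"
  shows "(\<integral>\<^sup>+x. f x \<partial>bernoulli_measure p) =
    (\<integral>\<^sup>+x. (\<integral>\<^sup>+v. f (x(m := v)) \<partial>bernoulli_pmf p) \<partial>bernoulli_measure p)"
proof -
  interpret B: prob_space "bernoulli_measure p" by (rule prob_space_bernoulli_measure)
  interpret P: pair_prob_space "measure_pmf (bernoulli_pmf p)" "bernoulli_measure p" ..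
  let ?P = "measure_pmf (bernoulli_pmf p) \<Otimes>\<^sub>M bernoulli_measure p"
  let ?u = "\<lambda>(v, x). x(m := v)"
  note u [measurable] = measurable_resample_cell[of m p]
  have "(\<integral>\<^sup>+x. f x \<partial>bernoulli_measure p) = (\<integral>\<^sup>+z. f (?u z) \<partial>?P)"
    by (subst distr_resample_cell[of p m, symmetric], rule nn_integral_distr) simp_all
  also have "\<dots> = (\<integral>\<^sup>+x. (\<integral>\<^sup>+v. f (?u (v, x)) \<partial>bernoulli_pmf p) \<partial>bernoulli_measure p)"
    by (rule P.nn_integral_snd[symmetric]) simp
  finally show ?thesis by simp
qed

text \<open>
  The peeling step: a factor whose mean over cell \<open>m\<close> is a constant \<open>C\<close>, whatever the other cells
  are, comes out of an integral in which no other factor depends on \<open>m\<close>.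
\<close>

lemma nn_integral_factor_out_cell:
  assumes [measurable]: "f \<in> borel_measurable config_space" "g \<in> borel_measurable config_space"
    and f: "\<And>x v. f (x(m := v)) = f x"
    and g: "\<And>x. (\<integral>\<^sup>+v. g (x(m := v)) \<partial>bernoulli_pmf p) = C"
  shows "(\<integral>\<^sup>+x. f x * g x \<partial>bernoulli_measure p) = C * (\<integral>\<^sup>+x. f x \<partial>bernoulli_measure p)"
proof -
  have "(\<integral>\<^sup>+x. f x * g x \<partial>bernoulli_measure p) =
      (\<integral>\<^sup>+x. (\<integral>\<^sup>+v. f x * g (x(m := v)) \<partial>bernoulli_pmf p) \<partial>bernoulli_measure p)"
    by (subst nn_integral_resample_cell[of _ p m]) (simp_all add: f)
  also have "\<dots> = (\<integral>\<^sup>+x. C * f x \<partial>bernoulli_measure p)"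
    by (simp add: nn_integral_cmult g mult.commute)
  also have "\<dots> = C * (\<integral>\<^sup>+x. f x \<partial>bernoulli_measure p)"
    by (rule nn_integral_cmult) (simp add: measurable_cong_sets[OF sets_bernoulli_measure refl])
  finally show ?thesis .
qed

section \<open>Balanced local rules and invariance\<close>

text \<open>
  The explicit form of \<open>\<theta>\<close> enters through two identities of laws, which say that the new cell is
  independent of the left cell that it reads, and independent of the right one. The right identity
  serves to sweep a row from right to left, the left identity to sweep it from left to right.
\<close>

locale balanced_pca =
  fixes p :: real and \<theta> :: "bool \<Rightarrow> bool \<Rightarrow> real"
  assumes params: "pca_params \<theta>"
    and balanced_right: "bind_pmf (bernoulli_pmf p) (\<lambda>v. bernoulli_pmf (\<theta> u v)) = bernoulli_pmf p"
    and balanced_left: "bind_pmf (bernoulli_pmf p) (\<lambda>u. bernoulli_pmf (\<theta> u v)) = bernoulli_pmf p"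
begin

definition hit :: "bool set \<Rightarrow> bool \<Rightarrow> bool \<Rightarrow> ennreal" where
  "hit S u v = emeasure (bernoulli_pmf (\<theta> u v)) S"

lemma hit_measurable [measurable]: "(\<lambda>x. hit S (x i) (x j)) \<in> borel_measurable config_space"
  by (rule borel_measurable_bool2) measurable

lemma nn_integral_hit_right: "(\<integral>\<^sup>+v. hit S u v \<partial>bernoulli_pmf p) = emeasure (bernoulli_pmf p) S"
  unfolding hit_def emeasure_bind_pmf[symmetric] by (simp only: balanced_right)

lemma nn_integral_hit_left: "(\<integral>\<^sup>+u. hit S u v \<partial>bernoulli_pmf p) = emeasure (bernoulli_pmf p) S"
  unfolding hit_def emeasure_bind_pmf[symmetric] by (simp only: balanced_left)

text \<open>
  The integral is the probability that \<open>x\<^sub>k \<in> S\<close> and that the next row takes values in \<open>T j\<close> at the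
  positions \<open>j \<in> J\<close>. The induction removes the last or the first position of \<open>J\<close>, one of which always reads
  a cell that no other position of \<open>J\<close> reads and that is not \<open>k\<close>; gaps in \<open>J\<close> do no harm to this.
\<close>

lemma nn_integral_cell_and_hits:
  assumes "finite J"
  shows "(\<integral>\<^sup>+x. indicator S (x k) * (\<Prod>j\<in>J. hit (T j) (x j) (x (j + 1))) \<partial>bernoulli_measure p)
    = emeasure (bernoulli_pmf p) S * (\<Prod>j\<in>J. emeasure (bernoulli_pmf p) (T j))"
  using assms
proof (induction J rule: finite_psubset_induct)
  case (psubset J)
  let ?f = "\<lambda>J x. indicator S (x k) * (\<Prod>j\<in>J. hit (T j) (x j) (x (j + 1))) :: ennreal"
  \<comment> \<open>Position \<open>m\<close> goes by integrating over cell \<open>i\<close>, which is \<open>m\<close> or \<open>m + 1\<close>.\<close>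
  have peel: ?case
    if m: "m \<in> J" "i \<noteq> k" "\<And>j. j \<in> J - {m} \<Longrightarrow> j \<noteq> i \<and> j + 1 \<noteq> i"
      and C: "\<And>x. (\<integral>\<^sup>+v. hit (T m) ((x(i := v)) m) ((x(i := v)) (m + 1)) \<partial>bernoulli_pmf p)
        = emeasure (bernoulli_pmf p) (T m)" for m i
  proof -
    have "(\<integral>\<^sup>+x. ?f J x \<partial>bernoulli_measure p)
        = (\<integral>\<^sup>+x. ?f (J - {m}) x * hit (T m) (x m) (x (m + 1)) \<partial>bernoulli_measure p)"
      using psubset(1) m(1) by (simp add: prod.remove mult_ac)
    also have "\<dots> = emeasure (bernoulli_pmf p) (T m) * (\<integral>\<^sup>+x. ?f (J - {m}) x \<partial>bernoulli_measure p)"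
    proof (rule nn_integral_factor_out_cell)
      show "?f (J - {m}) (x(i := v)) = ?f (J - {m}) x" for x v
        using m(2,3) by (intro arg_cong2[where f="(*)"] prod.cong) auto
      show "(\<integral>\<^sup>+v. hit (T m) ((x(i := v)) m) ((x(i := v)) (m + 1)) \<partial>bernoulli_pmf p)
        = emeasure (bernoulli_pmf p) (T m)" for x by (rule C)
    qed measurable
    also have "(\<integral>\<^sup>+x. ?f (J - {m}) x \<partial>bernoulli_measure p)
        = emeasure (bernoulli_pmf p) S * (\<Prod>j\<in>J - {m}. emeasure (bernoulli_pmf p) (T j))"
      using m(1) by (intro psubset.IH) auto
    finally show ?thesis
      using psubset(1) m(1) by (simp add: prod.remove mult_ac)
  qed
  consider "J = {}" | "J \<noteq> {}" "k \<le> Max J" | "J \<noteq> {}" "Max J < k" by linarith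
  then show ?case
  proof cases
    case 1
    interpret B: prob_space "bernoulli_measure p" by (rule prob_space_bernoulli_measure)
    have "(\<integral>\<^sup>+x. 1 * indicator S (x k) \<partial>bernoulli_measure p)
        = emeasure (bernoulli_pmf p) S * (\<integral>\<^sup>+x. 1 \<partial>bernoulli_measure p)"
      by (rule nn_integral_factor_out_cell[where m=k]) simp_all
    then show ?thesis using 1 B.emeasure_space_1 by simp
  next
    case 2
    \<comment> \<open>The cell right of the last position is read there only, and lies to the right of \<open>k\<close>.\<close>
    show ?thesis
    proof (rule peel[of "Max J" "Max J + 1"])
      show "j \<noteq> Max J + 1 \<and> j + 1 \<noteq> Max J + 1" if "j \<in> J - {Max J}" for j
        using that Max_ge[OF psubset(1), of j] by auto
    qed (use 2 psubset(1) in \<open>auto simp: nn_integral_hit_right\<close>)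
  next
    case 3
    \<comment> \<open>All of \<open>J\<close> lies to the left of \<open>k\<close>, so the first position itself is a cell read there only.\<close>
    have "Min J < k" using 3 psubset(1) by (metis Max_ge Min_in le_less_trans)
    moreover have "j \<noteq> Min J \<and> j + 1 \<noteq> Min J" if "j \<in> J - {Min J}" for j
      using that Min_le[OF psubset(1), of j] by auto
    moreover have "Min J \<in> J" using 3 psubset(1) by simp
    ultimately show ?thesis
      by (intro peel[of "Min J" "Min J"]) (simp_all add: nn_integral_hit_left)
  qed
qed

lemma nn_integral_hits:
  assumes "finite J"
  shows "(\<integral>\<^sup>+x. (\<Prod>j\<in>J. hit (T j) (x j) (x (j + 1))) \<partial>bernoulli_measure p)
    = (\<Prod>j\<in>J. emeasure (bernoulli_pmf p) (T j))"
  using nn_integral_cell_and_hits[OF assms, of UNIV 0 T]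
    measure_pmf.emeasure_space_1[of "bernoulli_pmf p"] by simp

lemma prob_space_pca_kernel: "prob_space (pca_kernel \<theta> x)"
  unfolding pca_kernel_def by (intro prob_space_PiM prob_space_measure_pmf)

lemma pca_kernel_measurable:
  "pca_kernel \<theta> \<in> measurable config_space (prob_algebra config_space)"
proof (rule measurable_prob_algebra_generated)
  let ?N = "\<lambda>_::int. count_space (UNIV::bool set)"
  show "sets config_space = sigma_sets UNIV (prod_algebra UNIV ?N)"
    unfolding config_space_def by (simp add: sets_PiM)
  show "Int_stable (prod_algebra UNIV ?N)" by (rule Int_stable_prod_algebra)
  fix A assume "A \<in> prod_algebra UNIV ?N"
  then obtain J S where J: "finite J" and A: "A = prod_emb UNIV ?N J (Pi\<^sub>E J S)"
    by (auto elim!: prod_algebraE)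
  have "(\<lambda>x. emeasure (pca_kernel \<theta> x) A) = (\<lambda>x. \<Prod>j\<in>J. hit (S j) (x j) (x (j + 1)))"
    using J by (simp add: A prod_emb_cylinder emeasure_pca_kernel_cylinder hit_def)
  then show "(\<lambda>x. emeasure (pca_kernel \<theta> x) A) \<in> borel_measurable config_space" by simp
qed (auto simp: prob_space_pca_kernel sets_pca_kernel)

theorem bernoulli_invariant: "pca_invariant \<theta> (bernoulli_measure p)"
  unfolding pca_invariant_def
proof (rule config_measure_eqI)
  interpret B: prob_space "bernoulli_measure p" by (rule prob_space_bernoulli_measure)
  have K: "pca_kernel \<theta> \<in> measurable (bernoulli_measure p) (subprob_algebra config_space)"
    using pca_kernel_measurable
    by (simp add: measurable_prob_algebraD measurable_cong_sets[OF sets_bernoulli_measure refl])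
  show sets: "sets (bernoulli_measure p \<bind> pca_kernel \<theta>) = sets config_space"
    by (intro sets_bind) (simp_all add: sets_pca_kernel)
  have cyl: "emeasure (bernoulli_measure p \<bind> pca_kernel \<theta>) {x. \<forall>j\<in>J. x j \<in> S j}
      = emeasure (bernoulli_measure p) {x. \<forall>j\<in>J. x j \<in> S j}" if "finite J" for J S
    using that K by (simp add: emeasure_bind cylinder_sets emeasure_pca_kernel_cylinder
      emeasure_bernoulli_cylinder nn_integral_hits[unfolded hit_def])
  then show "\<And>J S. finite J \<Longrightarrow> emeasure (bernoulli_measure p \<bind> pca_kernel \<theta>) {x. \<forall>j\<in>J. x j \<in> S j}
      = emeasure (bernoulli_measure p) {x. \<forall>j\<in>J. x j \<in> S j}" .
  show "finite_measure (bernoulli_measure p \<bind> pca_kernel \<theta>)"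
    using cyl[of "{}"] B.emeasure_space_1 sets_eq_imp_space_eq[OF sets]
    by (intro finite_measureI) simp
qed (rule sets_bernoulli_measure)

end

section \<open>The Markov property of a space-time diagram\<close>

lemma (in prob_space) indep_var_of_indep_vars:
  assumes "indep_vars (\<lambda>_. N) Y I" "a \<in> I" "b \<in> I" "a \<noteq> b"
  shows "indep_var N (Y a) N (Y b)"
proof -
  have "indep_var (PiM {a} (\<lambda>_. N)) (\<lambda>\<omega>. restrict (\<lambda>i. Y i \<omega>) {a})
      (PiM {b} (\<lambda>_. N)) (\<lambda>\<omega>. restrict (\<lambda>i. Y i \<omega>) {b})"
    using assms by (intro indep_var_restrict) auto
  from indep_var_compose[OF this, of "\<lambda>f. f a" N "\<lambda>f. f b" N]
  show ?thesis by (simp add: o_def)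
qed

locale balanced_diagram = balanced_pca +
  fixes M :: "'w measure" and X :: "int \<Rightarrow> int \<Rightarrow> 'w \<Rightarrow> bool"
  assumes diagram: "stationary_diagram \<theta> (bernoulli_measure p) M X"

sublocale balanced_diagram \<subseteq> prob_space M
  using diagram by (simp add: stationary_diagram_def)

context balanced_diagram
begin

abbreviation past :: "int \<Rightarrow> 'w measure" where "past n \<equiv> past_algebra M X n"

lemma X_measurable [measurable]: "X n k \<in> measurable M (count_space UNIV)"
  using diagram by (simp add: stationary_diagram_def)

lemma row_measurable [measurable]: "(\<lambda>\<omega> k. X n k \<omega>) \<in> measurable M config_space"
  unfolding config_space_def by (rule measurable_PiM_single') auto

lemma row_law: "distr M config_space (\<lambda>\<omega> k. X n k \<omega>) = bernoulli_measure p"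
  using diagram by (simp add: stationary_diagram_def)

lemma sets_past: "sets (past n) = sigma_sets (space M) {X m k -` A \<inter> space M | m k A. m \<le> n}"
  unfolding past_algebra_def by (rule sets_measure_of) auto

lemma space_past [simp]: "space (past n) = space M"
  unfolding past_algebra_def by (rule space_measure_of) auto

lemma subalgebra_past: "subalgebra M (past n)"
  unfolding subalgebra_def sets_past by (auto intro!: sets.sigma_sets_subset)

sublocale past: finite_measure_subalgebra M "past n" for n
  by unfold_locales (rule subalgebra_past)

lemma X_measurable_past: "m \<le> n \<Longrightarrow> X m k \<in> measurable (past n) (count_space UNIV)"
  by (intro measurableI) (auto simp: sets_past)

lemma past_mono: "A \<in> sets (past n) \<Longrightarrow> A \<in> sets (past (n + 1))"
proof -
  have "sets (past n) \<subseteq> sets (past (n + 1))"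
    unfolding sets_past by (intro sigma_sets_mono') force
  then show "A \<in> sets (past n) \<Longrightarrow> A \<in> sets (past (n + 1))" by blast
qed

lemma past_events: "A \<in> sets (past n) \<Longrightarrow> A \<in> events"
  using subalgebra_past unfolding subalgebra_def by blast

lemma cond_prob_cell:
  "AE \<omega> in M. real_cond_exp M (past n) (indicator (X (n + 1) k -` S \<inter> space M)) \<omega>
     = measure (bernoulli_pmf (\<theta> (X n k \<omega>) (X n (k + 1) \<omega>))) S"
proof -
  have \<theta>: "0 \<le> \<theta> u v" "\<theta> u v \<le> 1" for u v
    using params by (auto simp: pca_params_def)
  have t: "AE \<omega> in M. real_cond_exp M (past n) (indicator {\<omega> \<in> space M. X (n + 1) k \<omega>}) \<omega>
      = \<theta> (X n k \<omega>) (X n (k + 1) \<omega>)"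
    using diagram by (simp add: stationary_diagram_def)
  have one: "AE \<omega> in M. real_cond_exp M (past n) (\<lambda>_. 1) \<omega> = 1"
    by (rule past.real_cond_exp_F_meas) auto
  have "S \<in> Pow {False, True}"
    by (simp flip: UNIV_bool)
  then have "S = {} \<or> S = {True} \<or> S = {False} \<or> S = UNIV"
    by (simp add: Pow_insert UNIV_bool) blast
  then consider "S = {}" | "S = {True}" | "S = {False}" | "S = UNIV"
    by blast
  then show ?thesis
  proof cases
    case 1
    have "AE \<omega> in M. real_cond_exp M (past n) (indicator {}) \<omega> = indicator {} \<omega>"
      by (rule past.real_cond_exp_F_meas) auto
    then show ?thesis using 1 by simp
  next
    case 2
    have "X (n + 1) k -` S \<inter> space M = {\<omega> \<in> space M. X (n + 1) k \<omega>}" using 2 by auto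
    then show ?thesis using t 2 \<theta> by (simp add: measure_pmf_single)
  next
    case 3
    have "AE \<omega> in M. real_cond_exp M (past n) (indicator (X (n + 1) k -` S \<inter> space M)) \<omega> =
        real_cond_exp M (past n) (\<lambda>\<omega>. 1 - indicator {\<omega> \<in> space M. X (n + 1) k \<omega>} \<omega>) \<omega>"
      using 3 by (intro past.real_cond_exp_cong) (auto simp: indicator_def)
    moreover have "AE \<omega> in M.
        real_cond_exp M (past n) (\<lambda>\<omega>. 1 - indicator {\<omega> \<in> space M. X (n + 1) k \<omega>} \<omega>) \<omega> =
        real_cond_exp M (past n) (\<lambda>_. 1) \<omega>
          - real_cond_exp M (past n) (indicator {\<omega> \<in> space M. X (n + 1) k \<omega>}) \<omega>"
      by (rule past.real_cond_exp_diff) (auto intro!: integrable_const_bound[where B=1])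
    ultimately show ?thesis using t one
      by eventually_elim (simp add: 3 measure_pmf_single \<theta>)
  next
    case 4
    have "AE \<omega> in M. real_cond_exp M (past n) (indicator (X (n + 1) k -` S \<inter> space M)) \<omega> =
        real_cond_exp M (past n) (\<lambda>_. 1) \<omega>"
      using 4 by (intro past.real_cond_exp_cong) auto
    then show ?thesis using one
      by eventually_elim (use 4 measure_pmf.prob_space in simp)
  qed
qed

text \<open>
  This turns the conditional independence and the conditional probabilities given the past,
  which hold almost everywhere only, into one integral of a function of the current row, the form
  that the computation for \<open>\<mu>\<^sub>p\<close> can use.
\<close>

lemma emeasure_past_and_next_row:
  assumes A: "A \<in> sets (past n)" and J: "finite J"
  shows "emeasure M (A \<inter> {\<omega> \<in> space M. \<forall>j\<in>J. X (n + 1) j \<omega> \<in> S j})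
    = (\<integral>\<^sup>+\<omega>. indicator A \<omega> * (\<Prod>j\<in>J. hit (S j) (X n j \<omega>) (X n (j + 1) \<omega>)) \<partial>M)"
proof (cases "J = {}")
  case True
  then show ?thesis using past_events[OF A] sets.sets_into_space
    by (auto intro!: arg_cong[where f="emeasure M"])
next
  case False
  define C where "C = (\<Inter>j\<in>J. X (n + 1) j -` S j \<inter> space M)"
  define h where "h j \<omega> = measure (bernoulli_pmf (\<theta> (X n j \<omega>) (X n (j + 1) \<omega>))) (S j)" for j \<omega>
  have h_meas [measurable]: "h j \<in> borel_measurable M" for j
    unfolding h_def by (rule borel_measurable_bool2) measurable
  have A_meas [measurable]: "A \<in> events" by (rule past_events[OF A])
  have C_eq: "C = {\<omega> \<in> space M. \<forall>j\<in>J. X (n + 1) j \<omega> \<in> S j}"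
    using False by (auto simp: C_def)
  have C_meas [measurable]: "C \<in> events" unfolding C_eq using J by measurable
  have "cond_indep_vars M (past n) (\<lambda>_. count_space UNIV) (X (n + 1)) UNIV"
    using diagram by (simp add: stationary_diagram_def)
  then have "AE \<omega> in M. real_cond_exp M (past n) (indicator C) \<omega> =
      (\<Prod>j\<in>J. real_cond_exp M (past n) (indicator (X (n + 1) j -` S j \<inter> space M)) \<omega>)"
    using J False unfolding cond_indep_vars_def C_def by simp
  moreover have "AE \<omega> in M. \<forall>j\<in>J.
      real_cond_exp M (past n) (indicator (X (n + 1) j -` S j \<inter> space M)) \<omega> = h j \<omega>"
    unfolding h_def using J by (intro AE_finite_allI) (simp_all add: cond_prob_cell)
  ultimately have ce: "AE \<omega> in M. real_cond_exp M (past n) (indicator C) \<omega> = (\<Prod>j\<in>J. h j \<omega>)"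
    by eventually_elim simp
  have h01: "0 \<le> (\<Prod>j\<in>J. h j \<omega>)" "(\<Prod>j\<in>J. h j \<omega>) \<le> 1" for \<omega>
    unfolding h_def by (auto intro!: prod_nonneg prod_le_1)
  have "prob (A \<inter> C) = (\<integral>\<omega>\<in>A. indicator C \<omega> \<partial>M)"
    by (simp add: set_lebesgue_integral_def indicator_inter_arith[symmetric])
  also have "\<dots> = (\<integral>\<omega>\<in>A. real_cond_exp M (past n) (indicator C) \<omega> \<partial>M)"
  proof (rule past.real_cond_exp_intA[OF _ A])
    show "integrable M (indicator C :: 'w \<Rightarrow> real)"
      by (rule integrable_real_indicator) (simp_all add: emeasure_eq_measure)
  qed
  also have "\<dots> = (\<integral>\<omega>. indicator A \<omega> * (\<Prod>j\<in>J. h j \<omega>) \<partial>M)"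
    unfolding set_lebesgue_integral_def
    by (rule integral_cong_AE) (use ce in auto)
  finally have "emeasure M (A \<inter> C) = ennreal (\<integral>\<omega>. indicator A \<omega> * (\<Prod>j\<in>J. h j \<omega>) \<partial>M)"
    by (simp add: emeasure_eq_measure)
  also have "\<dots> = (\<integral>\<^sup>+\<omega>. ennreal (indicator A \<omega> * (\<Prod>j\<in>J. h j \<omega>)) \<partial>M)"
    by (rule nn_integral_eq_integral[symmetric])
      (auto intro!: integrable_const_bound[where B=1] simp: h01 indicator_def)
  also have "\<dots> = (\<integral>\<^sup>+\<omega>. indicator A \<omega> * (\<Prod>j\<in>J. hit (S j) (X n j \<omega>) (X n (j + 1) \<omega>)) \<partial>M)"
    by (intro nn_integral_cong)
      (simp add: h_def hit_def measure_pmf.emeasure_eq_measure prod_ennreal ennreal_mult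
        prod_nonneg ennreal_indicator)
  finally show ?thesis by (simp add: C_eq)
qed

section \<open>Decoupled events\<close>

text \<open>
  Independence of \<open>A\<close> and the row \<open>X\<^sup>n\<close>, as an equality of measures on configurations rather than as
  a product rule for events: integrals of arbitrary functions of the row are then immediate.
\<close>

definition decoupled :: "'w set \<Rightarrow> int \<Rightarrow> bool" where
  "decoupled A n \<longleftrightarrow> A \<in> sets (past n) \<and>
     distr (density M (indicator A)) config_space (\<lambda>\<omega> k. X n k \<omega>)
       = scale_measure (emeasure M A) (bernoulli_measure p)"

lemma decoupled_events: "decoupled A n \<Longrightarrow> A \<in> events"
  unfolding decoupled_def by (rule past_events[OF conjunct1])

lemma nn_integral_decoupled:
  assumes A: "decoupled A n" and f [measurable]: "f \<in> borel_measurable config_space"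
  shows "(\<integral>\<^sup>+\<omega>. indicator A \<omega> * f (\<lambda>k. X n k \<omega>) \<partial>M)
    = emeasure M A * (\<integral>\<^sup>+x. f x \<partial>bernoulli_measure p)"
proof -
  have [measurable]: "A \<in> events" using A by (rule decoupled_events)
  have "(\<integral>\<^sup>+\<omega>. indicator A \<omega> * f (\<lambda>k. X n k \<omega>) \<partial>M)
      = (\<integral>\<^sup>+x. f x \<partial>distr (density M (indicator A)) config_space (\<lambda>\<omega> k. X n k \<omega>))"
  proof (subst nn_integral_distr)
    show "(\<lambda>\<omega> k. X n k \<omega>) \<in> measurable (density M (indicator A)) config_space"
      using row_measurable[of n] by simp
    show "(\<integral>\<^sup>+\<omega>. indicator A \<omega> * f (\<lambda>k. X n k \<omega>) \<partial>M)
      = (\<integral>\<^sup>+\<omega>. f (\<lambda>k. X n k \<omega>) \<partial>density M (indicator A))"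
      by (rule nn_integral_density[symmetric])
        (simp, rule measurable_compose[OF row_measurable f])
  qed (simp add: f)
  also have "\<dots> = emeasure M A * (\<integral>\<^sup>+x. f x \<partial>bernoulli_measure p)"
    using A f unfolding decoupled_def
    by (simp only: nn_integral_scale_measure measurable_cong_sets[OF sets_bernoulli_measure refl])
  finally show ?thesis .
qed

lemma decoupled_space: "decoupled (space M) n"
proof -
  have "density M (indicator (space M)) = density M (\<lambda>_. 1)"
    by (rule density_cong) auto
  then show ?thesis
    using row_law[of n] sets.top[of "past n"]
    by (simp add: decoupled_def density_1 emeasure_space_1)
qed

lemma decoupled_cell:
  assumes A: "decoupled A n"
  shows "emeasure M (A \<inter> {\<omega> \<in> space M. X n k \<omega> \<in> S})
    = emeasure M A * emeasure (bernoulli_pmf p) S"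
proof -
  have [measurable]: "A \<in> events" using A by (rule decoupled_events)
  have "emeasure M (A \<inter> {\<omega> \<in> space M. X n k \<omega> \<in> S})
      = (\<integral>\<^sup>+\<omega>. indicator (A \<inter> {\<omega> \<in> space M. X n k \<omega> \<in> S}) \<omega> \<partial>M)"
    by (rule nn_integral_indicator[symmetric]) measurable
  also have "\<dots> = (\<integral>\<^sup>+\<omega>. indicator A \<omega> * indicator S (X n k \<omega>) \<partial>M)"
    by (intro nn_integral_cong) (auto simp: indicator_def)
  also have "\<dots> = emeasure M A * (\<integral>\<^sup>+x. indicator S (x k) \<partial>bernoulli_measure p)"
    using A by (rule nn_integral_decoupled) simp
  also have "(\<integral>\<^sup>+x. indicator S (x k) \<partial>bernoulli_measure p) = emeasure (bernoulli_pmf p) S"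
    using nn_integral_cell_and_hits[of "{}" S k] by simp
  finally show ?thesis .
qed

text \<open>
  Given \<open>A\<close>, the row \<open>X\<^sup>n\<close> still has law \<open>\<mu>\<^sub>p\<close>, and under \<open>\<mu>\<^sub>p\<close> a single cell is independent of the next
  row.
\<close>

lemma decoupled_step:
  assumes A: "decoupled A n"
  shows "decoupled (A \<inter> {\<omega> \<in> space M. X n k \<omega> \<in> S}) (n + 1)"
proof -
  let ?B = "A \<inter> {\<omega> \<in> space M. X n k \<omega> \<in> S}"
  have "{\<omega> \<in> space M. X n k \<omega> \<in> S} = X n k -` S \<inter> space (past n)" by auto
  then have B_past: "?B \<in> sets (past n)"
    using A measurable_sets[OF X_measurable_past[of n n k], of S] by (auto simp: decoupled_def)
  then have [measurable]: "?B \<in> events" by (rule past_events)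
  have "distr (density M (indicator ?B)) config_space (\<lambda>\<omega> k. X (n + 1) k \<omega>)
      = scale_measure (emeasure M ?B) (bernoulli_measure p)" (is "?D = _")
  proof (rule config_measure_eqI)
    show cyl: "emeasure ?D {x. \<forall>j\<in>J. x j \<in> T j}
        = emeasure (scale_measure (emeasure M ?B) (bernoulli_measure p)) {x. \<forall>j\<in>J. x j \<in> T j}"
      if J: "finite J" for J T
    proof -
      have row: "{\<omega> \<in> space M. \<forall>j\<in>J. X (n + 1) j \<omega> \<in> T j} \<in> events" using J by measurable
      have "emeasure ?D {x. \<forall>j\<in>J. x j \<in> T j}
          = emeasure (density M (indicator ?B)) {\<omega> \<in> space M. \<forall>j\<in>J. X (n + 1) j \<omega> \<in> T j}"
        using J by (subst emeasure_distr)
          (auto intro: cylinder_sets intro!: arg_cong[where f="emeasure _"])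
      also have "\<dots> = emeasure M (?B \<inter> {\<omega> \<in> space M. \<forall>j\<in>J. X (n + 1) j \<omega> \<in> T j})"
        using row by (subst emeasure_density)
          (simp_all add: indicator_inter_arith[symmetric])
      also have "\<dots> = (\<integral>\<^sup>+\<omega>. indicator ?B \<omega> * (\<Prod>j\<in>J. hit (T j) (X n j \<omega>) (X n (j + 1) \<omega>)) \<partial>M)"
        by (rule emeasure_past_and_next_row[OF B_past J])
      also have "\<dots> = (\<integral>\<^sup>+\<omega>. indicator A \<omega> * (indicator S (X n k \<omega>) *
          (\<Prod>j\<in>J. hit (T j) (X n j \<omega>) (X n (j + 1) \<omega>))) \<partial>M)"
        by (intro nn_integral_cong) (auto simp: indicator_def)
      also have "\<dots> = emeasure M A * (emeasure (bernoulli_pmf p) S *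
          (\<Prod>j\<in>J. emeasure (bernoulli_pmf p) (T j)))"
        by (subst nn_integral_decoupled[OF A]) (simp_all add: nn_integral_cell_and_hits[OF J])
      also have "\<dots> = emeasure (scale_measure (emeasure M ?B) (bernoulli_measure p)) {x. \<forall>j\<in>J. x j \<in> T j}"
        by (simp add: decoupled_cell[OF A] emeasure_bernoulli_cylinder[OF J] mult_ac)
      finally show ?thesis .
    qed
    show "finite_measure ?D"
      using cyl[of "{}" "\<lambda>_. UNIV"]
      by (intro finite_measureI) (simp add: emeasure_bernoulli_UNIV emeasure_eq_measure)
  qed (simp_all add: sets_bernoulli_measure)
  then show ?thesis using past_mono[OF B_past] by (simp add: decoupled_def)
qed

lemma decoupled_later:
  assumes A: "decoupled A n" and "n \<le> m"
  shows "decoupled A m"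
  using assms(2)
proof (induction m rule: int_ge_induct)
  case (step m)
  \<comment> \<open>Revealing nothing about a row is the case \<open>S = UNIV\<close> of revealing one of its cells.\<close>
  have "A \<in> events" using A by (rule decoupled_events)
  then have "A \<inter> {\<omega> \<in> space M. X m 0 \<omega> \<in> UNIV} = A"
    using sets.sets_into_space by auto
  with decoupled_step[OF step.IH, of 0 UNIV] show ?case by simp
qed (rule A)

section \<open>Independence along lines and of pairs\<close>

text \<open>
  One cell \<open>\<kappa> t\<close> is observed at each time \<open>t \<in> T\<close>, in the order of time. The product formula alone is not
  inductive: multiplying by the factor of the latest time \<open>b\<close> requires that the earlier observations
  are decoupled at \<open>b\<close>. This is claimed for every \<open>n\<close> after \<open>T\<close>, since the times may have gaps.
\<close>

lemma distinct_times:
  assumes "finite T"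
  shows "(\<forall>n. (\<forall>t\<in>T. t < n) \<longrightarrow> decoupled {\<omega> \<in> space M. \<forall>t\<in>T. X t (\<kappa> t) \<omega> \<in> S t} n) \<and>
    emeasure M {\<omega> \<in> space M. \<forall>t\<in>T. X t (\<kappa> t) \<omega> \<in> S t}
      = (\<Prod>t\<in>T. emeasure (bernoulli_pmf p) (S t))"
  using assms
proof (induction T rule: finite_linorder_max_induct)
  case empty
  then show ?case by (simp add: decoupled_space emeasure_space_1)
next
  case (insert b T)
  let ?A = "{\<omega> \<in> space M. \<forall>t\<in>T. X t (\<kappa> t) \<omega> \<in> S t}"
  have A: "decoupled ?A b" using insert by blast
  have eq: "{\<omega> \<in> space M. \<forall>t\<in>insert b T. X t (\<kappa> t) \<omega> \<in> S t}
      = ?A \<inter> {\<omega> \<in> space M. X b (\<kappa> b) \<omega> \<in> S b}" by auto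
  have "b \<notin> T" using insert.hyps by blast
  then show ?case
    unfolding eq decoupled_cell[OF A]
    using insert.IH insert.hyps(1) decoupled_later[OF decoupled_step[OF A]]
    by (auto simp: mult.commute)
qed

text \<open>
  The two cases are those of points on a line, with \<open>snd\<close> as the time: pairwise different times,
  where the observations can be ordered in time, or one common time, where they belong to one
  \<open>\<mu>\<^sub>p\<close>-distributed row.
\<close>

lemma emeasure_points:
  assumes J: "finite J" and "inj_on snd J \<or> (\<exists>t. \<forall>z\<in>J. snd z = t)"
  shows "emeasure M {\<omega> \<in> space M. \<forall>(k, n)\<in>J. X n k \<omega> \<in> S (k, n)}
    = (\<Prod>z\<in>J. emeasure (bernoulli_pmf p) (S z))"
  using assms(2)
proof
  assume inj: "inj_on snd J"
  define g where "g = the_inv_into J snd"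
  have g: "g (snd z) = z" if "z \<in> J" for z
    using inj that by (simp add: g_def the_inv_into_f_f)
  have "{\<omega> \<in> space M. \<forall>(k, n)\<in>J. X n k \<omega> \<in> S (k, n)}
      = {\<omega> \<in> space M. \<forall>t\<in>snd ` J. X t (fst (g t)) \<omega> \<in> S (g t)}"
    using g by (auto simp: case_prod_beta)
  also have "emeasure M \<dots> = (\<Prod>t\<in>snd ` J. emeasure (bernoulli_pmf p) (S (g t)))"
    using distinct_times[of "snd ` J" "\<lambda>t. fst (g t)" "\<lambda>t. S (g t)"] J by simp
  also have "\<dots> = (\<Prod>z\<in>J. emeasure (bernoulli_pmf p) (S z))"
    using g by (simp add: prod.reindex[OF inj])
  finally show ?thesis .
next
  assume "\<exists>t. \<forall>z\<in>J. snd z = t"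
  then obtain t where t: "\<And>z. z \<in> J \<Longrightarrow> snd z = t" by blast
  then have inj: "inj_on fst J" by (auto simp: inj_on_def prod_eq_iff)
  have pair: "(fst z, t) = z" if "z \<in> J" for z using t[OF that] by auto
  have "{\<omega> \<in> space M. \<forall>(k, n)\<in>J. X n k \<omega> \<in> S (k, n)}
      = (\<lambda>\<omega> k. X t k \<omega>) -` {x. \<forall>k\<in>fst ` J. x k \<in> S (k, t)} \<inter> space M"
  proof -
    have "(case z of (k, n) \<Rightarrow> X n k \<omega> \<in> S (k, n)) \<longleftrightarrow> X t (fst z) \<omega> \<in> S (fst z, t)" if "z \<in> J" for z \<omega>
      using t[OF that] by (cases z) simp
    then show ?thesis by auto
  qed
  also have "emeasure M \<dots> = emeasure (bernoulli_measure p) {x. \<forall>k\<in>fst ` J. x k \<in> S (k, t)}"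
    by (subst row_law[of t, symmetric], rule emeasure_distr[symmetric])
      (use J cylinder_sets[of "fst ` J" "\<lambda>k. S (k, t)"] in simp_all)
  also have "\<dots> = (\<Prod>k\<in>fst ` J. emeasure (bernoulli_pmf p) (S (k, t)))"
    by (rule emeasure_bernoulli_cylinder) (simp add: J)
  also have "\<dots> = (\<Prod>z\<in>J. emeasure (bernoulli_pmf p) (S z))"
    using pair by (simp add: prod.reindex[OF inj])
  finally show ?thesis .
qed

lemma cell_law: "emeasure M {\<omega> \<in> space M. X n k \<omega> \<in> S} = emeasure (bernoulli_pmf p) S"
  using emeasure_points[of "{(k, n)}" "\<lambda>_. S"] by simp

lemma indep_vars_points:
  assumes I: "inj_on snd I \<or> (\<exists>t. \<forall>z\<in>I. snd z = t)"
  shows "indep_vars (\<lambda>_. count_space UNIV) (\<lambda>(k, n). X n k) I"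
  unfolding indep_vars_def2
proof (intro conjI ballI indep_setsI)
  fix A and J :: "(int \<times> int) set"
  assume J: "J \<noteq> {}" "J \<subseteq> I" "finite J"
    and "\<forall>z\<in>J. A z \<in> {(case z of (k, n) \<Rightarrow> X n k) -` B \<inter> space M |B. B \<in> sets (count_space UNIV)}"
  then have "\<forall>z\<in>J. \<exists>B. A z = {\<omega> \<in> space M. X (snd z) (fst z) \<omega> \<in> B}"
    by (simp add: case_prod_beta vimage_def Int_def conj_commute)
  then obtain S where S: "\<And>z. z \<in> J \<Longrightarrow> A z = {\<omega> \<in> space M. X (snd z) (fst z) \<omega> \<in> S z}"
    by (auto dest: bchoice)
  have "inj_on snd J \<or> (\<exists>t. \<forall>z\<in>J. snd z = t)"
    using I J(2) by (meson inj_on_subset subsetD)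
  moreover have "(\<Inter>z\<in>J. A z) = {\<omega> \<in> space M. \<forall>(k, n)\<in>J. X n k \<omega> \<in> S (k, n)}"
    using J(1) by (auto simp: S case_prod_beta)
  ultimately have "emeasure M (\<Inter>z\<in>J. A z) = (\<Prod>z\<in>J. emeasure (bernoulli_pmf p) (S z))"
    using emeasure_points[OF J(3), of S] by simp
  also have "\<dots> = (\<Prod>z\<in>J. emeasure M (A z))"
    by (intro prod.cong refl) (simp add: S cell_law)
  finally show "prob (\<Inter>z\<in>J. A z) = (\<Prod>z\<in>J. prob (A z))"
    by (simp add: emeasure_eq_measure prod_ennreal prod_nonneg)
qed (auto simp: case_prod_beta)

lemma cells_identically_distributed:
  "distr M (count_space UNIV) (X n k) = measure_pmf (bernoulli_pmf p)"
proof (rule measure_eqI)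
  fix S :: "bool set"
  have "X n k -` S \<inter> space M = {\<omega> \<in> space M. X n k \<omega> \<in> S}" by auto
  then show "emeasure (distr M (count_space UNIV) (X n k)) S = emeasure (bernoulli_pmf p) S"
    by (simp add: emeasure_distr cell_law)
qed simp

lemma iid_line:
  assumes "inj_on snd I \<or> (\<exists>t. \<forall>z\<in>I. snd z = t)"
  shows "iid_vars M (count_space UNIV) (\<lambda>(k, n). X n k) I"
  using indep_vars_points[OF assms]
  by (auto simp: iid_vars_def cells_identically_distributed)

lemma indep_var_pair:
  assumes "(k, n) \<noteq> (k', n')"
  shows "indep_var (count_space UNIV) (X n k) (count_space UNIV) (X n' k')"
proof -
  let ?I = "{(k, n), (k', n')}"
  have "inj_on snd ?I \<or> (\<exists>t. \<forall>z\<in>?I. snd z = t)"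
    by (cases "n = n'") auto
  from indep_var_of_indep_vars[OF indep_vars_points[OF this], of "(k, n)" "(k', n')"] assms
  show ?thesis by simp
qed

end

text \<open>
  A line with two points of equal second coordinate is the affine hull of these points.
\<close>

lemma line_horizontal_or_graph:
  fixes L :: "(real \<times> real) set"
  assumes "straight_line L"
  shows "inj_on snd L \<or> (\<exists>t. \<forall>z\<in>L. snd z = t)"
proof (cases "inj_on snd L")
  case False
  then obtain a b where ab: "a \<in> L" "b \<in> L" "a \<noteq> b" "snd a = snd b"
    by (auto simp: inj_on_def)
  have L: "affine L" "aff_dim L = 1" using assms by (auto simp: straight_line_def)
  have "affine hull {a, b} = L"
    using L ab by (intro affine_dim_equal) (auto simp: hull_minimal)
  then have "\<forall>z\<in>L. snd z = snd a"
    using ab(4) by (auto simp: affine_hull_2 simp flip: distrib_right)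
  then show ?thesis by blast
qed simp

lemma lattice_line_horizontal_or_graph:
  assumes "straight_line L" and I: "I = {(k, n). (real_of_int k, real_of_int n) \<in> L}"
  shows "inj_on snd I \<or> (\<exists>t. \<forall>z\<in>I. snd z = t)"
  using line_horizontal_or_graph[OF assms(1)]
proof
  assume "inj_on snd L"
  then have "k = k'" if "(k, n) \<in> I" "(k', n) \<in> I" for k k' n
    using that inj_onD[of snd L "(real_of_int k, real_of_int n)" "(real_of_int k', real_of_int n)"]
    by (simp add: I)
  then have "inj_on snd I"
    by (auto simp: inj_on_def)
  then show ?thesis by simp
next
  assume "\<exists>t. \<forall>z\<in>L. snd z = t"
  then obtain t where "\<forall>z\<in>L. snd z = t" by blast
  then have "\<forall>z\<in>I. snd z = \<lfloor>t\<rfloor>" by (auto simp: I)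
  then show ?thesis by blast
qed

lemma bind_bernoulli_eqI:
  assumes p: "0 \<le> p" "p \<le> 1" and "\<And>v. f v \<in> {0..1::real}"
    and mean: "p * f True + (1 - p) * f False = p"
  shows "bind_pmf (bernoulli_pmf p) (\<lambda>v. bernoulli_pmf (f v)) = bernoulli_pmf p"
proof (rule pmf_eqI)
  have f: "0 \<le> f v" "f v \<le> 1" for v using assms(3)[of v] by auto
  fix b
  show "pmf (bind_pmf (bernoulli_pmf p) (\<lambda>v. bernoulli_pmf (f v))) b = pmf (bernoulli_pmf p) b"
    using p f mean by (cases b) (simp_all add: pmf_bind algebra_simps)
qed

theorem proposition4p4:
  fixes p s :: real and \<theta> :: "bool \<Rightarrow> bool \<Rightarrow> real"
    and M :: "'w measure" and X :: "int \<Rightarrow> int \<Rightarrow> 'w \<Rightarrow> bool"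
  assumes "0 < p" and "p < 1"
    and "pca_params \<theta>"
    and "(2 * p - 1) / p \<le> s" and "s \<le> p / (1 - p)"
    and "\<theta> False False = p * (1 - s) / (1 - p)"
    and "\<theta> False True = s"
    and "\<theta> True False = s"
    and "\<theta> True True = 1 - (1 - p) * s / p"
  shows "pca_invariant \<theta> (bernoulli_measure p) \<and>
    (stationary_diagram \<theta> (bernoulli_measure p) M X \<longrightarrow>
       (\<forall>L. straight_line L \<longrightarrow>
          iid_vars M (count_space UNIV) (\<lambda>(k, n). X n k)
            {(k, n). (real_of_int k, real_of_int n) \<in> L}) \<and>
       (\<forall>k n k' n'. (k, n) \<noteq> (k', n') \<longrightarrow>
          prob_space.indep_var M (count_space UNIV) (X n k) (count_space UNIV) (X n' k')))"
proof -
  have rng: "\<theta> u v \<in> {0..1}" for u v using assms(3) by (simp add: pca_params_def)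
  have "p * \<theta> u True + (1 - p) * \<theta> u False = p" "p * \<theta> True u + (1 - p) * \<theta> False u = p" for u
    using assms(1,2,6-9) by (cases u; simp add: field_simps)+
  then interpret balanced_pca p \<theta>
    using assms(1-3) rng by unfold_locales (auto intro!: bind_bernoulli_eqI)
  show ?thesis
  proof (intro conjI impI)
    show "pca_invariant \<theta> (bernoulli_measure p)" by (rule bernoulli_invariant)
    assume "stationary_diagram \<theta> (bernoulli_measure p) M X"
    then interpret balanced_diagram p \<theta> M X by unfold_locales
    show "\<forall>L. straight_line L \<longrightarrow> iid_vars M (count_space UNIV) (\<lambda>(k, n). X n k)
        {(k, n). (real_of_int k, real_of_int n) \<in> L}"
      using iid_line lattice_line_horizontal_or_graph[OF _ refl] by blast
    show "\<forall>k n k' n'. (k, n) \<noteq> (k', n') \<longrightarrow>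
        indep_var (count_space UNIV) (X n k) (count_space UNIV) (X n' k')"
      using indep_var_pair by blast
  qed
qed

end
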